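(* Let $f(\omega,x)\ge 0$ be the density of a probability distribution on the phase space $\mathbb{R}^n\times\mathbb{T}^n=\{\omega,\ x \bmod 2\pi\}$, so that $\int_{\mathbb{R}^n}\int_{\mathbb{T}^n}f\,d^nx\,d^n\omega=1$. Put $\overline{f}(\omega)=\frac{1}{(2\pi)^n}\int_{\mathbb{T}^n}f(\omega,x)\,d^nx$, and define the entropies $$S=-\int_{\mathbb{R}^n}\int_{\mathbb{T}^n}f(\omega,x)\ln f(\omega,x)\,d^nx\,d^n\omega,\qquad S_\infty=-(2\pi)^n\int_{\mathbb{R}^n}\overline{f}(\omega)\ln\overline{f}(\omega)\,d^n\omega .$$ Then $$S\le S_\infty .$$
   Context: $\mathbb{T}^n=(\mathbb{R}/2\pi\mathbb{Z})^n$ is the $n$-dimensional torus with Lebesgue measure $d^nx$ of total mass $(2\pi)^n$; as usual, $0\ln 0$ is read as $0$. The dynamics is $\dot x=\omega$, $\dot\omega=0$, under which the initial density $f(\omega,x)$ becomes $f(\omega,x-\omega t)$ at time $t$. $S$ is the entropy of the distribution $f$; replacing $x$ by $x-\omega t$ in the integrand does not change it, so it is constant in time. $S_\infty$ is interpreted as the entropy in the steady equilibrium state, whose density is $\overline{f}$, the limit in the generalized (weak) sense of $f(\omega,x-\omega t)$ as $t\to\infty$. The inequality expresses the law of thermodynamics on irreversible processes (increase of entropy). *)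

theory Defs
  imports "HOL-Analysis.Analysis"
begin

definition torus_rel :: "real ^ 'n::finite \<Rightarrow> real ^ 'n \<Rightarrow> bool" where
  "torus_rel x y \<longleftrightarrow> (\<forall>i. \<exists>k::int. x $ i - y $ i = 2 * pi * of_int k)"

lemma equivp_torus_rel: "equivp (torus_rel :: real ^ 'n::finite \<Rightarrow> _)"
proof (rule equivpI)
  show "reflp (torus_rel :: real ^ 'n::finite \<Rightarrow> _)"
    by (auto simp: reflp_def torus_rel_def intro: exI[of _ "0::int"])
  show "symp (torus_rel :: real ^ 'n::finite \<Rightarrow> _)"
  proof (rule sympI, unfold torus_rel_def, rule allI)
    fix x y :: "real ^ 'n" and i
    assume "\<forall>i. \<exists>k::int. x $ i - y $ i = 2 * pi * of_int k"
    then obtain k :: int where "x $ i - y $ i = 2 * pi * of_int k" by blast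
    then have "y $ i - x $ i = 2 * pi * of_int (- k)" by simp
    then show "\<exists>k::int. y $ i - x $ i = 2 * pi * of_int k" by blast
  qed
  show "transp (torus_rel :: real ^ 'n::finite \<Rightarrow> _)"
  proof (rule transpI, unfold torus_rel_def, rule allI)
    fix x y z :: "real ^ 'n" and i
    assume "\<forall>i. \<exists>k::int. x $ i - y $ i = 2 * pi * of_int k"
      and "\<forall>i. \<exists>k::int. y $ i - z $ i = 2 * pi * of_int k"
    then obtain k l :: int where "x $ i - y $ i = 2 * pi * of_int k" "y $ i - z $ i = 2 * pi * of_int l"
      by blast
    then have "x $ i - z $ i = 2 * pi * of_int (k + l)" by (simp add: algebra_simps)
    then show "\<exists>k::int. x $ i - z $ i = 2 * pi * of_int k" by blast
  qed
qed

quotient_type (overloaded) 'n torus = "real ^ ('n::finite)" / torus_rel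
  morphisms rep_torus torus_proj
  by (rule equivp_torus_rel)

text \<open>The torus carries the quotient topology.\<close>

instantiation torus :: (finite) topological_space
begin

definition open_torus :: "'a torus set \<Rightarrow> bool" where
  "open_torus U \<longleftrightarrow> open (torus_proj -` U)"

instance
proof
  show "open (UNIV :: 'a torus set)"
    by (simp add: open_torus_def)
  fix S T :: "'a torus set"
  show "open S \<Longrightarrow> open T \<Longrightarrow> open (S \<inter> T)"
    by (auto simp: open_torus_def vimage_Int)
next
  fix K :: "'a torus set set"
  show "\<forall>S\<in>K. open S \<Longrightarrow> open (\<Union>K)"
    by (auto simp: open_torus_def vimage_Union)
qed

end

definition torus_cell :: "(real ^ 'n::finite) set" where
  "torus_cell = {x. \<forall>i. 0 \<le> x $ i \<and> x $ i < 2 * pi}"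

text \<open>Lebesgue measure on the Borel sets of the torus: the image of Lebesgue measure on a
  fundamental cell.\<close>

definition torus_lborel :: "'n::finite torus measure" where
  "torus_lborel = distr (restrict_space lborel torus_cell) borel torus_proj"

text \<open>As with the library's \<^const>\<open>lebesgue\<close>, Lebesgue measurability is Borel measurability up to
  null sets, hence the completions.\<close>

definition torus_lebesgue :: "'n::finite torus measure" where
  "torus_lebesgue = completion torus_lborel"

definition phase_lebesgue :: "((real ^ 'n::finite) \<times> 'n torus) measure" where
  "phase_lebesgue = completion (lborel \<Otimes>\<^sub>M torus_lborel)"

lemma measurable_torus_proj: "torus_proj \<in> borel_measurable (borel :: (real ^ 'n::finite) measure)"
  by (rule borel_measurableI) (simp add: open_torus_def)

lemma torus_cell_borel: "torus_cell \<in> sets (borel :: (real ^ 'n::finite) measure)"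
  unfolding torus_cell_def by measurable

lemma emeasure_torus_lborel:
  "emeasure (torus_lborel :: 'n::finite torus measure) UNIV = ennreal ((2 * pi) ^ CARD('n))"
proof -
  let ?c = "(\<chi> i. 2 * pi) :: real ^ 'n"
  have prd: "(\<Prod>b\<in>Basis. (?c - 0) \<bullet> b) = (2 * pi) ^ CARD('n)"
  proof -
    have "(\<Prod>b\<in>Basis. (?c - 0) \<bullet> b) = (\<Prod>b\<in>(Basis :: (real ^ 'n) set). 2 * pi)"
      by (rule prod.cong) (auto simp: Basis_vec_def inner_axis)
    then show ?thesis by simp
  qed
  have le: "0 \<bullet> b \<le> ?c \<bullet> b" if "b \<in> Basis" for b
    using that by (auto simp: Basis_vec_def inner_axis)
  have sub: "box 0 ?c \<subseteq> torus_cell" "torus_cell \<subseteq> cbox 0 ?c"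
    by (auto simp: torus_cell_def mem_box_cart less_imp_le)
  have "emeasure lborel (torus_cell :: (real ^ 'n) set) = ennreal ((2 * pi) ^ CARD('n))"
  proof (rule antisym)
    have "emeasure lborel (torus_cell :: (real ^ 'n) set) \<le> emeasure lborel (cbox 0 ?c)"
      using sub by (intro emeasure_mono) auto
    then show "emeasure lborel (torus_cell :: (real ^ 'n) set) \<le> ennreal ((2 * pi) ^ CARD('n))"
      using le prd by (simp add: emeasure_lborel_cbox)
    have "emeasure lborel (box 0 ?c) \<le> emeasure lborel (torus_cell :: (real ^ 'n) set)"
      using sub torus_cell_borel by (intro emeasure_mono) auto
    then show "ennreal ((2 * pi) ^ CARD('n)) \<le> emeasure lborel (torus_cell :: (real ^ 'n) set)"
      using le prd by (simp add: emeasure_lborel_box)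
  qed
  moreover have "torus_proj \<in> measurable (restrict_space lborel torus_cell)
      (borel :: 'n torus measure)"
    by (rule measurable_restrict_space1) (use measurable_torus_proj in simp)
  moreover have "emeasure (restrict_space lborel torus_cell) (torus_cell :: (real ^ 'n) set)
      = emeasure lborel (torus_cell :: (real ^ 'n) set)"
    using torus_cell_borel by (subst emeasure_restrict_space) auto
  ultimately show ?thesis
    by (simp add: torus_lborel_def emeasure_distr space_restrict_space)
qed

text \<open>The Lebesgue integral of a real function with values in the extended reals. If the positive
  and the negative part both have infinite integral, then the integral does not exist, and the value
  is \<open>\<infinity>\<close> because \<open>\<infinity> - \<infinity> = \<infinity>\<close> in \<^typ>\<open>ereal\<close>; the entropies below, which carry a minus sign, then
  have the value \<open>-\<infinity>\<close>.\<close>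

definition ext_integral :: "'a measure \<Rightarrow> ('a \<Rightarrow> real) \<Rightarrow> ereal" where
  "ext_integral M g =
     enn2ereal (\<integral>\<^sup>+ x. ennreal (g x) \<partial>M) - enn2ereal (\<integral>\<^sup>+ x. ennreal (- g x) \<partial>M)"

lemma ext_integral_eq_integral:
  assumes "integrable M g"
  shows "ext_integral M g = ereal (integral\<^sup>L M g)"
proof -
  have fin: "(\<integral>\<^sup>+ x. ennreal (g x) \<partial>M) < \<infinity>" "(\<integral>\<^sup>+ x. ennreal (- g x) \<partial>M) < \<infinity>"
    using assms by (auto simp: real_integrable_def less_top)
  obtain a where a: "0 \<le> a" "(\<integral>\<^sup>+ x. ennreal (g x) \<partial>M) = ennreal a"
    using fin(1) by (cases "\<integral>\<^sup>+ x. ennreal (g x) \<partial>M") auto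
  obtain b where b: "0 \<le> b" "(\<integral>\<^sup>+ x. ennreal (- g x) \<partial>M) = ennreal b"
    using fin(2) by (cases "\<integral>\<^sup>+ x. ennreal (- g x) \<partial>M") auto
  show "ext_integral M g = ereal (integral\<^sup>L M g)"
    unfolding real_lebesgue_integral_def[OF assms] ext_integral_def a(2) b(2)
    using a(1) b(1) by (simp add: enn2ereal_ennreal)
qed

definition angle_avg :: "((real ^ 'n::finite) \<times> 'n torus \<Rightarrow> real) \<Rightarrow> real ^ 'n \<Rightarrow> real" where
  "angle_avg f \<omega> = 1 / (2 * pi) ^ CARD('n) * (\<integral> x. f (\<omega>, x) \<partial>torus_lebesgue)"

text \<open>The convention on \<open>0 ln 0\<close> holds automatically, since \<open>ln 0 = 0\<close> in the library.\<close>

definition phase_entropy :: "((real ^ 'n::finite) \<times> 'n torus \<Rightarrow> real) \<Rightarrow> ereal" where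
  "phase_entropy f = - ext_integral phase_lebesgue (\<lambda>z. f z * ln (f z))"

definition limit_entropy :: "((real ^ 'n::finite) \<times> 'n torus \<Rightarrow> real) \<Rightarrow> ereal" where
  "limit_entropy f =
     - (ereal ((2 * pi) ^ CARD('n)) * ext_integral lebesgue (\<lambda>\<omega>. angle_avg f \<omega> * ln (angle_avg f \<omega>)))"

end

theory Submission imports Defs begin

text \<open>Jensen's inequality for \<open>\<phi> y = y ln y\<close> on each fibre \<open>{\<omega>} \<times> T\<close>: integrating the tangent line of
  \<open>\<phi>\<close> at the fibre average \<open>a \<omega>\<close> gives \<open>(2\<pi>)\<^sup>n \<phi> (a \<omega>) \<le> \<integral> \<phi> (f (\<omega>, x)) dx\<close>. Since the entropies may be
  infinite, the positive and negative parts are integrated over \<open>\<omega>\<close> separately, and the inequality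
  is written without subtraction. The negative part of \<open>\<phi> \<circ> f\<close> is finite on every fibre because
  \<open>\<phi> \<ge> -1\<close> and the torus has finite measure.\<close>

text \<open>By convexity the graph of \<open>y ln y\<close> lies above its tangent at
  \<open>a\<close>; for \<open>y > 0\<close> this is \<open>ln t \<le> t - 1\<close> at
  \<open>t = a / y\<close>, multiplied by \<open>y\<close>.\<close>

lemma mult_ln_ge_tangent:
  fixes a y :: real
  assumes "0 < a" "0 \<le> y"
  shows "y * ln a + y - a \<le> y * ln y"
proof (cases "y = 0")
  case False
  with assms have y: "0 < y" by simp
  have "y * ln (a / y) \<le> y * (a / y - 1)"
    using y assms by (intro mult_left_mono ln_le_minus_one) auto
  with y assms show ?thesis by (simp add: ln_div algebra_simps)
qed (use assms in simp)

text \<open>Jensen via the tangent at the mean \<open>a\<close>: the terms \<open>h - a\<close>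
  integrate to zero, leaving the integral of \<open>h * ln a\<close>. At \<open>a = 0\<close> there
  is no tangent, but then \<open>h\<close> vanishes almost everywhere.\<close>

lemma (in finite_measure) mult_ln_average_le:
  fixes h :: "'a \<Rightarrow> real"
  assumes c: "0 < measure M (space M)"
    and h: "integrable M h" "\<And>x. 0 \<le> h x"
    and \<phi>: "integrable M (\<lambda>x. h x * ln (h x))"
    and a: "a = (\<integral>x. h x \<partial>M) / measure M (space M)"
  shows "measure M (space M) * (a * ln a) \<le> (\<integral>x. h x * ln (h x) \<partial>M)"
proof (cases "a = 0")
  case True
  then have "(\<integral>x. h x \<partial>M) = 0" using a c by simp
  then have "AE x in M. h x = 0"
    using integral_nonneg_eq_0_iff_AE[OF h(1)] h(2) by simp
  then have "(\<integral>x. h x * ln (h x) \<partial>M) = 0" by (intro integral_eq_zero_AE) auto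
  with True show ?thesis by simp
next
  case False
  moreover have "0 \<le> a" unfolding a using h(2) by simp
  ultimately have pos: "0 < a" by simp
  have ha: "(\<integral>x. h x \<partial>M) = measure M (space M) * a" using a c by simp
  have "(\<integral>x. h x * ln a + h x - a \<partial>M) \<le> (\<integral>x. h x * ln (h x) \<partial>M)"
    using h \<phi> mult_ln_ge_tangent[OF pos] by (intro integral_mono) auto
  then show ?thesis using h(1) by (simp add: ha algebra_simps)
qed

lemma ext_integral_mult_ln_average_le:
  fixes g :: "'a \<times> 'b \<Rightarrow> real"
  assumes "sigma_finite_measure M" "finite_measure N"
    and c: "c = measure N (space N)" "0 < c"
    and g: "integrable (M \<Otimes>\<^sub>M N) g" "\<And>z. 0 \<le> g z"
    and a: "\<And>x. a x = (\<integral>y. g (x, y) \<partial>N) / c"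
  shows "ereal c * ext_integral M (\<lambda>x. a x * ln (a x)) \<le> ext_integral (M \<Otimes>\<^sub>M N) (\<lambda>z. g z * ln (g z))"
proof -
  interpret M: sigma_finite_measure M by fact
  interpret N: finite_measure N by fact
  interpret pair_sigma_finite M N ..
  define \<phi> :: "real \<Rightarrow> real" where "\<phi> y = y * ln y" for y
  have [measurable]: "\<phi> \<in> borel_measurable borel" unfolding \<phi>_def by measurable
  have g_meas [measurable]: "g \<in> borel_measurable (M \<Otimes>\<^sub>M N)" using g(1) by auto
  have a_meas [measurable]: "a \<in> borel_measurable M"
    unfolding a by measurable
  define p where "p x = (\<integral>\<^sup>+y. ennreal (\<phi> (g (x, y))) \<partial>N)" for x
  define n where "n x = (\<integral>\<^sup>+y. ennreal (- \<phi> (g (x, y))) \<partial>N)" for x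
  have [measurable]: "p \<in> borel_measurable M" "n \<in> borel_measurable M"
    unfolding p_def n_def by measurable
  define P where "P = (\<integral>\<^sup>+z. ennreal (\<phi> (g z)) \<partial>(M \<Otimes>\<^sub>M N))"
  define Q where "Q = (\<integral>\<^sup>+z. ennreal (- \<phi> (g z)) \<partial>(M \<Otimes>\<^sub>M N))"
  define P' where "P' = (\<integral>\<^sup>+x. ennreal (\<phi> (a x)) \<partial>M)"
  define Q' where "Q' = (\<integral>\<^sup>+x. ennreal (- \<phi> (a x)) \<partial>M)"
  have P: "P = (\<integral>\<^sup>+x. p x \<partial>M)" and Q: "Q = (\<integral>\<^sup>+x. n x \<partial>M)"
    unfolding P_def Q_def p_def n_def by (rule N.nn_integral_fst[symmetric], measurable)+
  have "ereal c * (enn2ereal P' - enn2ereal Q') \<le> enn2ereal P - enn2ereal Q"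
  proof (cases "P = \<infinity>")
    case True \<comment> \<open>this also covers \<open>Q = \<infinity>\<close>, as \<open>\<infinity> - \<infinity> = \<infinity>\<close> in \<^typ>\<open>ereal\<close>\<close>
    then show ?thesis by simp
  next
    case False
    have n_fin: "n x < \<infinity>" for x
    proof -
      have "n x \<le> (\<integral>\<^sup>+y. 1 \<partial>N)" unfolding n_def
      proof (rule nn_integral_mono)
        fix y show "ennreal (- \<phi> (g (x, y))) \<le> 1"
          \<comment> \<open>The tangent at 1 gives
            \<open>\<phi> y \<ge> y - 1 \<ge> -1\<close>.\<close>
          using mult_ln_ge_tangent[of 1 "g (x, y)"] g(2)[of "(x, y)"]
          by (simp add: \<phi>_def)
      qed
      also have "\<dots> < \<infinity>" by (simp add: less_top[symmetric])
      finally show ?thesis .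
    qed
    have "AE x in M. p x \<noteq> \<infinity>"
      using False P by (intro nn_integral_PInf_AE) auto
    moreover have "AE x in M. integrable N (\<lambda>y. g (x, y))"
      by (rule AE_integrable_fst'[OF g(1)])
    \<comment> \<open>The first conjunct is fibrewise Jensen with the negative parts moved across.
      The second bounds the positive part alone; it will keep \<open>P'\<close> finite even when
      \<open>Q'\<close> is infinite.\<close>
    ultimately have fib: "AE x in M. n x + ennreal c * ennreal (\<phi> (a x)) \<le> p x + ennreal c * ennreal (- \<phi> (a x))
        \<and> ennreal c * ennreal (\<phi> (a x)) \<le> p x"
      using AE_space
    proof eventually_elim
      case (elim x)
      then have [measurable]: "(\<lambda>y. g (x, y)) \<in> borel_measurable N" by auto
      have int: "integrable N (\<lambda>y. \<phi> (g (x, y)))"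
        using elim n_fin[of x] unfolding real_integrable_def p_def n_def by auto
      have le: "c * \<phi> (a x) \<le> (\<integral>y. \<phi> (g (x, y)) \<partial>N)"
        unfolding \<phi>_def c(1)
        by (rule N.mult_ln_average_le) (use c elim g(2) int in \<open>auto simp: a \<phi>_def\<close>)
      obtain r where r: "0 \<le> r" "p x = ennreal r" using elim by (cases "p x") auto
      obtain s where s: "0 \<le> s" "n x = ennreal s" using n_fin[of x] by (cases "n x") auto
      have "(\<integral>y. \<phi> (g (x, y)) \<partial>N) = r - s"
        unfolding real_lebesgue_integral_def[OF int] p_def[symmetric] n_def[symmetric]
        using r s by simp
      with le have le': "c * \<phi> (a x) \<le> r - s" by simp
      show ?case
      \<comment> \<open>The sign decides which of the two parts of \<open>\<phi> (a x)\<close> is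
        sent to 0 by \<open>ennreal\<close>.\<close>
      proof (cases "0 \<le> \<phi> (a x)")
        case True
        with le' r s c show ?thesis
          by (simp add: ennreal_neg ennreal_mult[symmetric] ennreal_plus[symmetric] del: ennreal_plus)
      next
        case False
        with c have "0 \<le> c * - \<phi> (a x)" by (intro mult_nonneg_nonneg) auto
        with False le' r s c show ?thesis
          by (simp add: ennreal_neg ennreal_mult[symmetric] ennreal_plus[symmetric] del: ennreal_plus)
      qed
    qed
    have "Q + ennreal c * P' = (\<integral>\<^sup>+x. n x + ennreal c * ennreal (\<phi> (a x)) \<partial>M)"
      unfolding Q P'_def by (simp add: nn_integral_add nn_integral_cmult)
    also have "\<dots> \<le> (\<integral>\<^sup>+x. p x + ennreal c * ennreal (- \<phi> (a x)) \<partial>M)"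
      using fib by (intro nn_integral_mono_AE) auto
    also have "\<dots> = P + ennreal c * Q'"
      unfolding P Q'_def by (simp add: nn_integral_add nn_integral_cmult)
    finally have balance: "Q + ennreal c * P' \<le> P + ennreal c * Q'" .
    have "ennreal c * P' = (\<integral>\<^sup>+x. ennreal c * ennreal (\<phi> (a x)) \<partial>M)"
      unfolding P'_def by (simp add: nn_integral_cmult)
    also have "\<dots> \<le> P"
      unfolding P using fib by (intro nn_integral_mono_AE) auto
    finally have P'_le: "ennreal c * P' \<le> P" .
    obtain r where r: "0 \<le> r" "P = ennreal r" using False by (cases P) auto
    obtain r' where r': "0 \<le> r'" "P' = ennreal r'"
      using P'_le r c by (cases P') (auto simp: ennreal_mult_top top_unique)
    show ?thesis
    proof (cases Q')
      case (real s')
      then obtain s where s: "0 \<le> s" "Q = ennreal s"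
        using balance r r' c
        by (cases Q) (auto simp: ennreal_mult[symmetric] ennreal_plus[symmetric] top_unique simp del: ennreal_plus)
      have "s + c * r' \<le> r + c * s'"
        using balance real r r' s c
        by (simp add: ennreal_mult[symmetric] ennreal_plus[symmetric] del: ennreal_plus)
      then show ?thesis using real r r' s by (simp add: enn2ereal_ennreal algebra_simps)
    next
      \<comment> \<open>Since \<open>P'\<close> is finite, the left-hand side is
        \<open>-\<infinity>\<close>.\<close>
      case top
      then show ?thesis using r' c by (simp add: enn2ereal_ennreal)
    qed
  qed
  then show ?thesis
    unfolding ext_integral_def P_def Q_def P'_def Q'_def \<phi>_def .
qed

text \<open>Preimages under \<open>f\<close> and \<open>g\<close> differ by a null set, which the
  completion absorbs.\<close>

lemma borel_measurable_completion_cong_AE: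
  fixes f g :: "'a \<Rightarrow> 'b::topological_space"
  assumes g: "g \<in> borel_measurable M" and eq: "AE x in M. f x = g x"
  shows "f \<in> borel_measurable (completion M)"
proof (rule measurableI)
  fix A :: "'b set" assume A: "A \<in> sets borel"
  show "f -` A \<inter> space (completion M) \<in> sets (completion M)"
  proof (rule completion.in_sets_AE)
    show "AE x in completion M. x \<in> g -` A \<inter> space M \<longleftrightarrow> x \<in> f -` A \<inter> space (completion M)"
      using AE_completion[OF eq] by eventually_elim auto
    show "g -` A \<inter> space M \<in> sets (completion M)"
      using measurable_sets[OF g A] by simp
  qed simp
qed simp

lemma integral_completion_cong_AE:
  fixes f g :: "'a \<Rightarrow> 'b::{banach, second_countable_topology}"
  assumes g: "g \<in> borel_measurable M" and eq: "AE x in M. f x = g x"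
  shows "integral\<^sup>L (completion M) f = integral\<^sup>L M g"
proof -
  have "integral\<^sup>L (completion M) f = integral\<^sup>L (completion M) g"
    using borel_measurable_completion_cong_AE[OF assms] g eq
    by (intro integral_cong_AE) (auto intro: AE_completion measurable_completion)
  also have "\<dots> = integral\<^sup>L M g" by (rule integral_completion[OF g])
  finally show ?thesis .
qed

text \<open>Nonnegative integrals over the completion and over \<open>M\<close> agree for every
  function, measurable or not, so almost-everywhere equality suffices.\<close>

lemma ext_integral_completion_cong_AE:
  assumes "AE x in M. f x = g x"
  shows "ext_integral (completion M) f = ext_integral M g"
proof -
  have "(\<integral>\<^sup>+x. ennreal (f x) \<partial>M) = (\<integral>\<^sup>+x. ennreal (g x) \<partial>M)"
    "(\<integral>\<^sup>+x. ennreal (- f x) \<partial>M) = (\<integral>\<^sup>+x. ennreal (- g x) \<partial>M)"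
    using assms by (auto intro!: nn_integral_cong_AE)
  then show ?thesis unfolding ext_integral_def nn_integral_completion by simp
qed

theorem mainTheorem4:
  fixes f :: "(real ^ 'n::finite) \<times> 'n torus \<Rightarrow> real"
  assumes f_measurable: "f \<in> borel_measurable phase_lebesgue"
    and f_nonneg: "\<And>\<omega> x. f (\<omega>, x) \<ge> 0"
    and f_total: "(\<integral>z. f z \<partial>phase_lebesgue) = 1"
  shows "phase_entropy f \<le> limit_entropy f"
proof -
  let ?M = "lborel :: (real ^ 'n) measure" and ?N = "torus_lborel :: 'n torus measure"
  let ?c = "(2 * pi) ^ CARD('n)"
  have space: "space ?N = UNIV" by (simp add: torus_lborel_def)
  interpret N: finite_measure ?N
    by (rule finite_measureI) (simp add: space emeasure_torus_lborel)
  interpret pair_sigma_finite ?M ?N ..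
  \<comment> \<open>Fubini is applied on the uncompleted product, so \<open>f\<close> is replaced by
    a Borel representative; truncating it at 0 makes it nonnegative everywhere.\<close>
  obtain h where h: "h \<in> borel_measurable (?M \<Otimes>\<^sub>M ?N)" "AE z in ?M \<Otimes>\<^sub>M ?N. f z = h z"
    using completion_ex_borel_measurable_real[of f "?M \<Otimes>\<^sub>M ?N"] f_measurable
    unfolding phase_lebesgue_def by blast
  define g where "g z = max 0 (h z)" for z
  have g_meas [measurable]: "g \<in> borel_measurable (?M \<Otimes>\<^sub>M ?N)"
    unfolding g_def using h(1) by measurable
  have fg: "AE z in ?M \<Otimes>\<^sub>M ?N. f z = g z"
    using h(2)
  proof eventually_elim
    case (elim z)
    then show ?case using f_nonneg[of "fst z" "snd z"] by (simp add: g_def)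
  qed
  have "integral\<^sup>L (?M \<Otimes>\<^sub>M ?N) g = 1"
    using f_total integral_completion_cong_AE[OF g_meas fg] unfolding phase_lebesgue_def by simp
  \<comment> \<open>A non-integrable function has Bochner integral 0 by convention, so the value 1
    forces integrability.\<close>
  then have g_int: "integrable (?M \<Otimes>\<^sub>M ?N) g"
    using not_integrable_integral_eq by fastforce
  define a where "a \<omega> = (\<integral>x. g (\<omega>, x) \<partial>?N) / ?c" for \<omega>
  \<comment> \<open>On almost every fibre the slices of \<open>f\<close> and \<open>g\<close> agree
    almost everywhere, so their averages coincide.\<close>
  have "AE \<omega> in ?M. angle_avg f \<omega> = a \<omega>"
    using AE_pair[OF fg]
  proof eventually_elim
    case (elim \<omega>)
    have "(\<lambda>x. g (\<omega>, x)) \<in> borel_measurable ?N" by measurable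
    from integral_completion_cong_AE[OF this elim] show ?case
      unfolding angle_avg_def a_def torus_lebesgue_def by simp
  qed
  then have "ext_integral lebesgue (\<lambda>\<omega>. angle_avg f \<omega> * ln (angle_avg f \<omega>))
      = ext_integral ?M (\<lambda>\<omega>. a \<omega> * ln (a \<omega>))"
    by (intro ext_integral_completion_cong_AE) auto
  moreover have "ext_integral phase_lebesgue (\<lambda>z. f z * ln (f z))
      = ext_integral (?M \<Otimes>\<^sub>M ?N) (\<lambda>z. g z * ln (g z))"
    unfolding phase_lebesgue_def using fg by (intro ext_integral_completion_cong_AE) auto
  moreover have "ereal ?c * ext_integral ?M (\<lambda>\<omega>. a \<omega> * ln (a \<omega>))
      \<le> ext_integral (?M \<Otimes>\<^sub>M ?N) (\<lambda>z. g z * ln (g z))"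
  proof (rule ext_integral_mult_ln_average_le)
    show "?c = measure ?N (space ?N)"
      by (simp add: measure_def space emeasure_torus_lborel)
    show "0 \<le> g z" for z by (simp add: g_def)
  qed (use g_int in \<open>auto simp: a_def sigma_finite_lborel N.finite_measure_axioms\<close>)
  ultimately show ?thesis
    unfolding phase_entropy_def limit_entropy_def by simp
qed

end
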